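(* For any integer $n \geq 2$, the Laplacian eigenvalue $4n$ of the power graph $\mathcal{G}(Q_n)$ has multiplicity two if $Q_n$ is generalized quaternion (i.e., $n$ is a power of $2$) and multiplicity one otherwise.
   Context: For $n\ge 2$, the dicyclic group $Q_n$ is the group of order $4n$ with presentation $\langle a,b \mid a^{2n}=e,\ a^n=b^2,\ ab=ba^{-1}\rangle$; it is generalized quaternion when $n$ is a power of $2$. The power graph $\mathcal{G}(G)$ of a group $G$ has vertex set $G$, distinct $u,v$ adjacent iff one is a positive power of the other. Laplacian eigenvalues are eigenvalues of $L(\Gamma)=D(\Gamma)-A(\Gamma)$. *)

theory Defs
  imports
    "HOL-Algebra.Group"
    "Graph_Theory.Pair_Digraph"
    "Jordan_Normal_Form.Char_Poly"
begin

section \<open>Groups given by generators and relations\<close>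

text \<open>A word over the generators is a list of letters; the letter \<open>(x, True)\<close> stands for \<open>x\<close>
  and \<open>(x, False)\<close> for the formal inverse of \<open>x\<close>.\<close>

type_synonym 'g word = "('g \<times> bool) list"

text \<open>The congruence on words generated by the relations \<open>l = r\<close>, for \<open>(l, r) \<in> R\<close>, together
  with the cancellation of adjacent mutually inverse letters.\<close>

inductive pres_eq :: "('g word \<times> 'g word) set \<Rightarrow> 'g word \<Rightarrow> 'g word \<Rightarrow> bool"
  for R :: "('g word \<times> 'g word) set"
where
  rel: "(l, r) \<in> R \<Longrightarrow> pres_eq R l r"
| cancel: "pres_eq R [(x, s), (x, \<not> s)] []"
| refl: "pres_eq R u u"
| sym: "pres_eq R u v \<Longrightarrow> pres_eq R v u"
| trans: "pres_eq R u v \<Longrightarrow> pres_eq R v w \<Longrightarrow> pres_eq R u w"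
| append: "pres_eq R u u' \<Longrightarrow> pres_eq R v v' \<Longrightarrow> pres_eq R (u @ v) (u' @ v')"

definition pres_class :: "('g word \<times> 'g word) set \<Rightarrow> 'g word \<Rightarrow> 'g word set" where
  "pres_class R u = {v. pres_eq R u v}"

definition presented_group :: "('g word \<times> 'g word) set \<Rightarrow> 'g word set monoid" where
  "presented_group R =
     \<lparr> carrier = range (pres_class R),
       mult = (\<lambda>X Y. {w. \<exists>x\<in>X. \<exists>y\<in>Y. pres_eq R (x @ y) w}),
       one = pres_class R [] \<rparr>"

declare pres_eq.trans [trans]

lemma pres_class_eq_iff: "pres_class R u = pres_class R v \<longleftrightarrow> pres_eq R u v"
  unfolding pres_class_def by (auto intro: pres_eq.intros)

lemma presented_group_mult:
  "pres_class R u \<otimes>\<^bsub>presented_group R\<^esub> pres_class R v = pres_class R (u @ v)"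
  unfolding presented_group_def pres_class_def
  by (auto intro: pres_eq.intros)

lemma presented_group_one: "\<one>\<^bsub>presented_group R\<^esub> = pres_class R []"
  by (simp add: presented_group_def)

lemma presented_group_carrier: "carrier (presented_group R) = range (pres_class R)"
  by (simp add: presented_group_def)

lemma pres_eq_inverse_word: "\<exists>v. pres_eq R (v @ u) []"
proof (induction u)
  case Nil
  show ?case by (metis append_Nil pres_eq.refl)
next
  case (Cons a u)
  then obtain v where v: "pres_eq R (v @ u) []" by blast
  obtain x s where a: "a = (x, s)" by force
  have c: "pres_eq R [(x, \<not> s), (x, s)] []"
    using pres_eq.cancel[of R x "\<not> s"] by simp
  have "pres_eq R (v @ ([(x, \<not> s), (x, s)] @ u)) (v @ ([] @ u))"
    by (intro pres_eq.append pres_eq.refl c)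
  then have "pres_eq R ((v @ [(x, \<not> s)]) @ a # u) (v @ u)" by (simp add: a)
  then show ?case using v pres_eq.trans by blast
qed

lemma group_presented_group: "group (presented_group R)"
proof (rule groupI)
  fix X assume "X \<in> carrier (presented_group R)"
  then obtain u where X: "X = pres_class R u" by (auto simp: presented_group_carrier)
  obtain v where "pres_eq R (v @ u) []" using pres_eq_inverse_word by blast
  then show "\<exists>Y\<in>carrier (presented_group R).
      Y \<otimes>\<^bsub>presented_group R\<^esub> X = \<one>\<^bsub>presented_group R\<^esub>"
    unfolding X presented_group_carrier presented_group_one
    by (intro bexI[of _ "pres_class R v"]) (auto simp: presented_group_mult pres_class_eq_iff)
qed (auto simp: presented_group_carrier presented_group_mult presented_group_one)

section \<open>The dicyclic groups\<close>

datatype dic_gen = Gen_a | Gen_b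

abbreviation (input) "wa \<equiv> (Gen_a, True)"
abbreviation (input) "wa_inv \<equiv> (Gen_a, False)"
abbreviation (input) "wb \<equiv> (Gen_b, True)"

definition dicyclic_relations :: "nat \<Rightarrow> (dic_gen word \<times> dic_gen word) set" where
  "dicyclic_relations n =
     { (replicate (2 * n) wa, []),
       (replicate n wa, [wb, wb]),
       ([wa, wb], [wb, wa_inv]) }"

definition dicyclic_group :: "nat \<Rightarrow> dic_gen word set monoid" where
  "dicyclic_group n = presented_group (dicyclic_relations n)"

lemma group_dicyclic_group: "group (dicyclic_group n)"
  by (simp add: dicyclic_group_def group_presented_group)

subsection \<open>The dicyclic group has order \<open>4n\<close>\<close>

text \<open>Left multiplication on the normal forms \<open>a\<^sup>i b\<^sup>j\<close>, encoded as pairs \<open>(i, j)\<close>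
  with \<open>0 \<le> i < 2n\<close> and \<open>j\<close> a Boolean.\<close>

fun dic_step :: "nat \<Rightarrow> dic_gen \<times> bool \<Rightarrow> int \<times> bool \<Rightarrow> int \<times> bool" where
  "dic_step n (Gen_a, True) (i, j) = ((i + 1) mod (2 * int n), j)"
| "dic_step n (Gen_a, False) (i, j) = ((i - 1) mod (2 * int n), j)"
| "dic_step n (Gen_b, True) (i, False) = ((- i) mod (2 * int n), True)"
| "dic_step n (Gen_b, True) (i, True) = ((int n - i) mod (2 * int n), False)"
| "dic_step n (Gen_b, False) (i, False) = ((int n - i) mod (2 * int n), True)"
| "dic_step n (Gen_b, False) (i, True) = ((- i) mod (2 * int n), False)"

lemma dic_step_closed:
  assumes "n > 0"
  shows "fst (dic_step n l p) \<in> {0..<2 * int n}"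
  using assms by (cases "(n, l, p)" rule: dic_step.cases) auto

lemma foldr_dic_step_closed:
  assumes "n > 0" "fst p \<in> {0..<2 * int n}"
  shows "fst (foldr (dic_step n) w p) \<in> {0..<2 * int n}"
  using assms by (cases w) (auto simp: dic_step_closed simp del: atLeastLessThan_iff)

lemma dic_step_cancel:
  assumes "fst p \<in> {0..<2 * int n}"
  shows "dic_step n (x, s) (dic_step n (x, \<not> s) p) = p"
  using assms
  by (cases p; cases x; cases s; cases "snd p") (auto simp: mod_simps)

lemma foldr_dic_step_a:
  assumes "i \<in> {0..<2 * int n}"
  shows "foldr (dic_step n) (replicate k wa) (i, j) = ((i + int k) mod (2 * int n), j)"
  using assms by (induction k) (auto simp: mod_simps algebra_simps)

lemma foldr_dic_step_relation:
  assumes "(l, r) \<in> dicyclic_relations n" "fst p \<in> {0..<2 * int n}"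
  shows "foldr (dic_step n) l p = foldr (dic_step n) r p"
proof -
  obtain i j where p: "p = (i, j)" by force
  with assms(2) have i: "i \<in> {0..<2 * int n}" by simp
  have "(i + int n) mod (2 * int n) = (i - int n + 2 * int n) mod (2 * int n)"
    by (simp add: add.commute del: mod_add_self2 mod_add_self1)
  also have "\<dots> = (i - int n) mod (2 * int n)" by (rule mod_add_self2)
  finally have n_shift: "(i - int n) mod (2 * int n) = (i + int n) mod (2 * int n)" ..
  have bb: "foldr (dic_step n) [wb, wb] (i, j) = ((i + int n) mod (2 * int n), j)"
    using n_shift by (cases j) (auto simp: mod_simps algebra_simps)
  have ab: "foldr (dic_step n) [wa, wb] (i, j) = foldr (dic_step n) [wb, wa_inv] (i, j)"
    by (cases j) (auto simp: mod_simps algebra_simps)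
  show ?thesis
    using assms(1) foldr_dic_step_a[OF i, of "2 * n" j] foldr_dic_step_a[OF i, of n j] bb ab i
    unfolding dicyclic_relations_def p by (auto simp del: foldr.simps) auto
qed

lemma pres_eq_imp_foldr_dic_step_eq:
  assumes "pres_eq (dicyclic_relations n) u v" "n > 0" "fst p \<in> {0..<2 * int n}"
  shows "foldr (dic_step n) u p = foldr (dic_step n) v p"
  using assms
proof (induction arbitrary: p rule: pres_eq.induct)
  case (rel l r)
  then show ?case using foldr_dic_step_relation by blast
next
  case (cancel x s)
  then show ?case using dic_step_cancel by simp
next
  case (append u u' v v')
  then show ?case using foldr_dic_step_closed[of n p v] by simp
qed auto

abbreviation (input) "dic_nf i j \<equiv> replicate i wa @ replicate j wb"

lemma dic_normal_form_exists:
  assumes n: "n > 0"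
  shows "\<exists>i j. i < 2 * n \<and> j < 2 \<and> pres_eq (dicyclic_relations n) w (dic_nf i j)"
proof -
  define E where "E = pres_eq (dicyclic_relations n)"
  have tr [trans]: "E u v \<Longrightarrow> E v w \<Longrightarrow> E u w" for u v w
    unfolding E_def by (rule pres_eq.trans)
  have sy: "E u v \<Longrightarrow> E v u" for u v
    unfolding E_def by (rule pres_eq.sym)
  have re: "E u u" for u unfolding E_def by (rule pres_eq.refl)
  have mid: "E u v \<Longrightarrow> E (x @ u @ y) (x @ v @ y)" for u v x y
    unfolding E_def by (intro pres_eq.append pres_eq.refl)
  have left: "E u v \<Longrightarrow> E (x @ u) (x @ v)" for u v x
    using mid[of u v x "[]"] by simp
  have right: "E u v \<Longrightarrow> E (u @ x) (v @ x)" for u v x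
    using mid[of u v "[]" x] by simp
  have a2n: "E (replicate (2 * n) wa) []" and an: "E (replicate n wa) [wb, wb]"
    and ab: "E [wa, wb] [wb, wa_inv]"
    unfolding E_def by (auto intro!: pres_eq.rel simp: dicyclic_relations_def)
  have ainv: "E [wa_inv, wa] []" and binv: "E [(Gen_b, False), wb] []"
    unfolding E_def using pres_eq.cancel[of _ _ False] by auto
  define m where "m = 2 * n - 1"
  have m: "Suc m = 2 * n" using n by (simp add: m_def)
  have ainv': "E [wa_inv] (replicate m wa)"
  proof -
    have "E ([wa_inv] @ []) ([wa_inv] @ replicate (Suc m) wa)"
      unfolding m by (intro left sy[OF a2n])
    also have "E ([wa_inv] @ replicate (Suc m) wa) ([] @ replicate m wa)"
      using right[OF ainv, of "replicate m wa"] by simp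
    finally show ?thesis by simp
  qed
  have b4: "E (replicate 4 wb) []"
  proof -
    have "E ([wb, wb] @ [wb, wb]) (replicate n wa @ [wb, wb])" by (intro right sy[OF an])
    also have "E (replicate n wa @ [wb, wb]) (replicate n wa @ replicate n wa)"
      by (intro left sy[OF an])
    also have "replicate n wa @ replicate n wa = replicate (2 * n) wa"
      by (simp add: replicate_add[symmetric] mult_2)
    also note a2n
    finally show ?thesis by (simp add: numeral_eq_Suc)
  qed
  have binv': "E [(Gen_b, False)] (replicate 3 wb)"
  proof -
    have "E ([(Gen_b, False)] @ []) ([(Gen_b, False)] @ replicate 4 wb)"
      by (intro left sy[OF b4])
    also have "E ([(Gen_b, False)] @ replicate 4 wb) ([] @ replicate 3 wb)"
      using right[OF binv, of "replicate 3 wb"] by (simp add: numeral_eq_Suc)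
    finally show ?thesis by simp
  qed
  have ba: "E [wb, wa] (replicate m wa @ [wb])"
  proof -
    have "E ([] @ [wb, wa]) (replicate (Suc m) wa @ [wb, wa])"
      unfolding m by (intro right sy[OF a2n])
    also have "replicate (Suc m) wa @ [wb, wa] = replicate m wa @ [wa, wb] @ [wa]"
      by (simp add: replicate_append_same[symmetric])
    also have "E (replicate m wa @ [wa, wb] @ [wa]) (replicate m wa @ [wb, wa_inv] @ [wa])"
      by (intro mid ab)
    also have "E (replicate m wa @ [wb, wa_inv] @ [wa]) (replicate m wa @ [wb])"
      using left[OF ainv, of "replicate m wa @ [wb]"] by simp
    finally show ?thesis by simp
  qed
  have bai: "E ([wb] @ replicate i wa) (replicate (m * i) wa @ [wb])" for i
  proof (induction i)
    case 0
    show ?case by (simp add: re)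
  next
    case (Suc i)
    have "E ([wb, wa] @ replicate i wa) ((replicate m wa @ [wb]) @ replicate i wa)"
      by (intro right ba)
    also have "(replicate m wa @ [wb]) @ replicate i wa =
        replicate m wa @ ([wb] @ replicate i wa)" by simp
    also have "E \<dots> (replicate m wa @ (replicate (m * i) wa @ [wb]))"
      by (intro left Suc.IH)
    finally show ?case by (simp add: replicate_add)
  qed
  define N where "N w \<longleftrightarrow> (\<exists>i j. E w (dic_nf i j))" for w
  have N_a: "N (wa # w)" if "N w" for w
  proof -
    from that obtain i j where "E w (dic_nf i j)" unfolding N_def by blast
    from left[OF this, of "[wa]"] have "E (wa # w) (dic_nf (Suc i) j)" by simp
    then show ?thesis unfolding N_def by blast
  qed
  have N_b: "N (wb # w)" if "N w" for w
  proof -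
    from that obtain i j where "E w (dic_nf i j)" unfolding N_def by blast
    from left[OF this, of "[wb]"] have "E (wb # w) (([wb] @ replicate i wa) @ replicate j wb)"
      by simp
    also have "E \<dots> ((replicate (m * i) wa @ [wb]) @ replicate j wb)"
      by (intro right bai)
    also have "\<dots> = dic_nf (m * i) (Suc j)" by simp
    finally show ?thesis unfolding N_def by blast
  qed
  have N_as: "N (replicate k wa @ w)" and N_bs: "N (replicate k wb @ w)" if "N w" for k w
    using that by (induction k) (auto intro: N_a N_b)
  have N_E: "N u" if "E u v" "N v" for u v
    using that tr unfolding N_def by blast
  have "N w"
  proof (induction w)
    case Nil
    have "E [] (dic_nf 0 0)" by (simp add: re)
    then show ?case unfolding N_def by blast
  next
    case (Cons l w)
    obtain x s where l: "l = (x, s)" by force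
    show ?case
    proof (cases x; cases s)
      assume "x = Gen_a" "s" then show ?thesis using N_a[OF Cons.IH] l by simp
    next
      assume "x = Gen_b" "s" then show ?thesis using N_b[OF Cons.IH] l by simp
    next
      assume "x = Gen_a" "\<not> s"
      then show ?thesis using N_E[OF right[OF ainv'] N_as[OF Cons.IH]] l by simp
    next
      assume "x = Gen_b" "\<not> s"
      then show ?thesis using N_E[OF right[OF binv'] N_bs[OF Cons.IH]] l by simp
    qed
  qed
  then obtain i j where ij: "E w (dic_nf i j)" unfolding N_def by blast
  have red_b: "\<exists>i' j'. j' < 2 \<and> E (dic_nf i j) (dic_nf i' j')" for i j
  proof (induction j arbitrary: i rule: less_induct)
    case (less j)
    show ?case
    proof (cases "j < 2")
      case True
      then show ?thesis using re by blast
    next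
      case False
      then obtain k where k: "j = Suc (Suc k)" by (metis less_2_cases_iff not0_implies_Suc One_nat_def)
      have "E (replicate i wa @ [wb, wb] @ replicate k wb)
              (replicate i wa @ replicate n wa @ replicate k wb)"
        by (intro mid sy[OF an])
      then have 1: "E (dic_nf i j) (dic_nf (i + n) k)" by (simp add: k replicate_add)
      show ?thesis using less.IH[of k "i + n"] tr[OF 1] k by auto
    qed
  qed
  have red_a: "\<exists>i'. i' < 2 * n \<and> E (dic_nf i j) (dic_nf i' j)" for i j
  proof (induction i rule: less_induct)
    case (less i)
    show ?case
    proof (cases "i < 2 * n")
      case True
      then show ?thesis using re by blast
    next
      case False
      then have i: "i = 2 * n + (i - 2 * n)" by simp
      have "E (replicate (2 * n) wa @ dic_nf (i - 2 * n) j) ([] @ dic_nf (i - 2 * n) j)"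
        by (intro right a2n)
      then have 1: "E (dic_nf i j) (dic_nf (i - 2 * n) j)"
        by (subst i) (simp add: replicate_add)
      show ?thesis using less.IH[of "i - 2 * n"] tr[OF 1] False n by auto
    qed
  qed
  obtain i1 j1 where 1: "j1 < 2" "E (dic_nf i j) (dic_nf i1 j1)" using red_b by blast
  obtain i2 where 2: "i2 < 2 * n" "E (dic_nf i1 j1) (dic_nf i2 j1)" using red_a by blast
  have "E w (dic_nf i2 j1)" using ij 1(2) 2(2) tr by blast
  then show ?thesis using 1(1) 2(1) unfolding E_def by blast
qed

lemma dic_normal_form_unique:
  assumes n: "n > 0"
    and "i < 2 * n" "j < 2" "i' < 2 * n" "j' < 2"
    and eq: "pres_eq (dicyclic_relations n) (dic_nf i j) (dic_nf i' j')"
  shows "i = i' \<and> j = j'"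
proof -
  have ev: "foldr (dic_step n) (dic_nf i j) (0, False) = (int i, j = 1)"
    if "i < 2 * n" "j < 2" for i j
  proof -
    have "foldr (dic_step n) (replicate j wb) (0, False) = (0, j = 1)"
      using that by (cases "j = 0") (auto simp: less_2_cases_iff)
    then show ?thesis using that n foldr_dic_step_a[of 0 n i "j = 1"] by simp
  qed
  have "(int i, j = 1) = (int i', j' = 1)"
    using pres_eq_imp_foldr_dic_step_eq[OF eq n, of "(0, False)"] ev assms by auto
  then show ?thesis using assms by auto
qed

lemma card_dicyclic_group:
  assumes n: "n > 0"
  shows "card (carrier (dicyclic_group n)) = 4 * n"
proof -
  let ?f = "\<lambda>(i, j). pres_class (dicyclic_relations n) (dic_nf i j)"
  let ?S = "{..<2 * n} \<times> {..<2::nat}"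
  have "inj_on ?f ?S"
    using dic_normal_form_unique[OF n]
    by (auto simp: inj_on_def pres_class_eq_iff)
  moreover have "?f ` ?S = carrier (dicyclic_group n)"
  proof
    show "carrier (dicyclic_group n) \<subseteq> ?f ` ?S"
    proof
      fix X assume "X \<in> carrier (dicyclic_group n)"
      then obtain w where X: "X = pres_class (dicyclic_relations n) w"
        by (auto simp: dicyclic_group_def presented_group_carrier)
      obtain i j where "i < 2 * n" "j < 2"
        "pres_eq (dicyclic_relations n) w (dic_nf i j)"
        using dic_normal_form_exists[OF n] by blast
      then show "X \<in> ?f ` ?S"
        unfolding X by (intro image_eqI[of _ _ "(i, j)"]) (auto simp: pres_class_eq_iff)
    qed
  qed (auto simp: dicyclic_group_def presented_group_carrier)
  ultimately have "card (carrier (dicyclic_group n)) = card ?S"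
    by (metis card_image)
  then show ?thesis by simp
qed

section \<open>Power graphs and the Laplacian matrix\<close>

text \<open>As usual in \<open>Graph_Theory\<close>, an undirected simple graph is a loop-free digraph with
  symmetric arc set (see \<open>pair_graph_power_graph\<close> below).\<close>

definition power_graph :: "('a, 'b) monoid_scheme \<Rightarrow> 'a pair_pre_digraph" where
  "power_graph G =
     \<lparr> pverts = carrier G,
       parcs = {(u, v). u \<in> carrier G \<and> v \<in> carrier G \<and> u \<noteq> v \<and>
                  ((\<exists>k::nat. k > 0 \<and> u = v [^]\<^bsub>G\<^esub> k) \<or> (\<exists>k::nat. k > 0 \<and> v = u [^]\<^bsub>G\<^esub> k))} \<rparr>"

lemma pair_graph_power_graph:
  assumes "finite (carrier G)"
  shows "pair_graph (power_graph G)"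
proof
  show "finite (parcs (power_graph G))"
    by (rule finite_subset[of _ "carrier G \<times> carrier G"]) (auto simp: power_graph_def assms)
  show "symmetric (with_proj (power_graph G))"
    by (auto simp: symmetric_def power_graph_def sym_def)
qed (auto simp: power_graph_def assms)

text \<open>The matrices below depend on an enumeration \<open>vs\<close> of the vertices, which indexes the rows and
  columns. In a symmetric digraph the degree of a vertex is its out-degree.\<close>

definition adjacency_mat :: "'v pair_pre_digraph \<Rightarrow> 'v list \<Rightarrow> real mat" where
  "adjacency_mat \<Gamma> vs = Matrix.mat (length vs) (length vs)
     (\<lambda>(i, j). if (vs ! i, vs ! j) \<in> parcs \<Gamma> then 1 else 0)"

definition degree_mat :: "'v pair_pre_digraph \<Rightarrow> 'v list \<Rightarrow> real mat" where
  "degree_mat \<Gamma> vs = mat_diag (length vs) (\<lambda>i. real (out_degree (with_proj \<Gamma>) (vs ! i)))"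

definition laplacian_mat :: "'v pair_pre_digraph \<Rightarrow> 'v list \<Rightarrow> real mat" where
  "laplacian_mat \<Gamma> vs = degree_mat \<Gamma> vs - adjacency_mat \<Gamma> vs"

definition eigenvalue_multiplicity :: "real mat \<Rightarrow> real \<Rightarrow> nat" where
  "eigenvalue_multiplicity A x = Polynomial.order x (char_poly A)"

end

theory Submission
  imports
    Defs
    "Jordan_Normal_Form.Jordan_Normal_Form_Uniqueness"
    "Jordan_Normal_Form.Jordan_Normal_Form_Existence"
    "HOL-Algebra.Multiplicative_Group"
    "HOL-Number_Theory.Cong"
begin

text \<open>On a graph with \<open>N\<close> vertices, \<open>N I - L\<close> is the Laplacian of the complement plus the all-ones
  matrix, so its kernel consists of the vectors of coordinate sum zero that are constant on the
  components of the complement. For a symmetric matrix, algebraic and geometric multiplicities agree.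
  Hence, if the non-dominating vertices form a single component of the complement, the multiplicity of
  \<open>N\<close> is the number of dominating vertices. In the power graph of \<open>Q\<^sub>n\<close>, no \<open>a\<^sup>i\<close> with \<open>i \<noteq> 0, n\<close>
  is adjacent to any \<open>a\<^sup>j b\<close>, since \<open>\<langle>a\<^sup>j b\<rangle>\<close> meets \<open>\<langle>a\<rangle>\<close> only in the identity and \<open>a\<^sup>n\<close>. The identity
  always dominates, and the involution \<open>a\<^sup>n\<close> dominates iff every nontrivial subgroup of \<open>\<langle>a\<rangle>\<close>
  has even order, i.e. iff \<open>n\<close> is a power of two.\<close>

section \<open>Symmetric matrices\<close>

lemma kernel_dim_cong:
  assumes "A \<in> carrier_mat n m" "B \<in> carrier_mat n m" "mat_kernel A = mat_kernel B"
  shows "kernel_dim A = kernel_dim B"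
  using assms by (simp add: kernel_dim_def)

text \<open>Comparing the first two generalised eigenspaces shows that all Jordan blocks for \<open>e\<close> have
  size one.\<close>

lemma order_char_poly_eq_kernel_dim:
  fixes A :: "complex mat"
  assumes A: "A \<in> carrier_mat n n"
    and semisimple: "\<And>v. v \<in> carrier_vec n \<Longrightarrow> char_matrix A e *\<^sub>v (char_matrix A e *\<^sub>v v) = 0\<^sub>v n
      \<Longrightarrow> char_matrix A e *\<^sub>v v = 0\<^sub>v n"
  shows "Polynomial.order e (char_poly A) = kernel_dim (char_matrix A e)"
proof -
  let ?M = "char_matrix A e"
  have M: "?M \<in> carrier_mat n n" using A by simp
  obtain nas where jnf: "jordan_nf A nas"
    using char_poly_factorized[OF A] jordan_nf_exists[OF A] by blast
  have "mat_kernel (?M ^\<^sub>m 2) = mat_kernel (?M ^\<^sub>m 1)"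
    using M semisimple by (auto simp: mat_kernel_def numeral_2_eq_2)
  then have "dim_gen_eigenspace A e 2 = dim_gen_eigenspace A e 1"
    unfolding dim_gen_eigenspace_def using M by (intro kernel_dim_cong[of _ n n]) auto
  moreover define ks where "ks = map fst [(n, x)\<leftarrow>nas . x = e]"
  ultimately have eq: "(\<Sum>k\<leftarrow>ks. min 2 k) = (\<Sum>k\<leftarrow>ks. min 1 k)"
    using dim_gen_eigenspace[OF jnf, of e] by simp
  \<comment> \<open>A block of size \<open>k\<close> contributes \<open>min d k\<close> to the
    kernel dimension of the \<open>d\<close>-th power. Since \<open>min 1 k \<le> min 2 k\<close>,
    equal sums force every \<open>k \<le> 1\<close>.\<close>
  have "sum_list ks = (\<Sum>k\<leftarrow>ks. min 1 k)"
    using eq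
  proof (induction ks)
    case (Cons k ks)
    have "(\<Sum>k\<leftarrow>ks. min 1 k) \<le> (\<Sum>k\<leftarrow>ks. min 2 k)" by (rule sum_list_mono) simp
    with Cons show ?case by (auto simp: min_def split: if_splits)
  qed simp
  moreover have "Polynomial.order e (char_poly A) = sum_list ks"
    unfolding jordan_nf_order[OF jnf] ks_def by (simp add: case_prod_beta')
  moreover have "kernel_dim ?M = (\<Sum>k\<leftarrow>ks. min 1 k)"
    using dim_gen_eigenspace[OF jnf, of e 1] M by (simp add: dim_gen_eigenspace_def ks_def)
  ultimately show ?thesis by simp
qed

text \<open>A matrix with real entries commutes with complex conjugation, so symmetry makes its
  complexification self-adjoint for the Hermitian product.\<close>

lemma scalar_prod_conjugate_real_mat:
  fixes R :: "real mat"
  assumes R: "R \<in> carrier_mat n n" and sym: "transpose_mat R = R"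
    and v: "v \<in> carrier_vec n" and w: "w \<in> carrier_vec n"
  shows "(map_mat complex_of_real R *\<^sub>v v) \<bullet>c w = v \<bullet>c (map_mat complex_of_real R *\<^sub>v w)"
proof -
  let ?M = "map_mat complex_of_real R"
  have M: "?M \<in> carrier_mat n n" using R by simp
  have sM: "transpose_mat ?M = ?M"
    using sym by (metis map_mat_transpose)
  have "conjugate (?M *\<^sub>v w) = ?M *\<^sub>v conjugate w"
    using R w by (intro eq_vecI) (auto simp: scalar_prod_def)
  then show ?thesis
    using transpose_vec_mult_scalar[of ?M n n "conjugate w" v] M sM v w by simp
qed

text \<open>Over the complex numbers the characteristic polynomial splits, which yields a Jordan
  form, and extending scalars preserves the order of a root. Self-adjointness gives
  \<open><Mv, Mv> = <v, M(Mv)>\<close>, hence semisimplicity.\<close>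

lemma order_char_poly_symmetric:
  fixes A :: "real mat"
  assumes A: "A \<in> carrier_mat n n" and sym: "transpose_mat A = A"
  shows "Polynomial.order e (char_poly A)
    = kernel_dim (map_mat complex_of_real (char_matrix A e))"
proof -
  let ?c = "map_mat complex_of_real"
  let ?M = "?c (char_matrix A e)"
  have R: "char_matrix A e \<in> carrier_mat n n" using A by simp
  have M: "?M \<in> carrier_mat n n" using R by simp
  have symR: "transpose_mat (char_matrix A e) = char_matrix A e"
    using A sym unfolding char_matrix_def by (subst transpose_add[of _ n n]) (auto intro!: eq_matI)
  have cM: "char_matrix (?c A) (complex_of_real e) = ?M"
    using A by (intro eq_matI) (auto simp: char_matrix_def)
  interpret map_poly_inj_idom_divide_hom complex_of_real by unfold_locales
  have "Polynomial.order e (char_poly A) = Polynomial.order (complex_of_real e) (char_poly (?c A))"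
    by (simp add: of_real_hom.char_poly_hom[OF A] order_hom)
  also have "\<dots> = kernel_dim ?M"
    unfolding cM[symmetric]
  proof (rule order_char_poly_eq_kernel_dim)
    show "?c A \<in> carrier_mat n n" using A by simp
    fix v :: "complex vec"
    assume v: "v \<in> carrier_vec n"
      and 0: "char_matrix (?c A) (complex_of_real e) *\<^sub>v (char_matrix (?c A) (complex_of_real e) *\<^sub>v v) = 0\<^sub>v n"
    have Mv: "?M *\<^sub>v v \<in> carrier_vec n" using M v by simp
    have "(?M *\<^sub>v v) \<bullet>c (?M *\<^sub>v v) = v \<bullet>c (?M *\<^sub>v (?M *\<^sub>v v))"
      by (rule scalar_prod_conjugate_real_mat[OF R symR v Mv])
    also have "\<dots> = 0" using 0 v by (simp add: cM)
    finally show "char_matrix (?c A) (complex_of_real e) *\<^sub>v v = 0\<^sub>v n"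
      using conjugate_square_eq_0_vec[OF Mv] by (simp add: cM)
  qed
  finally show ?thesis .
qed

text \<open>The coordinates in \<open>D\<close> act as a dual basis: by \<open>delta\<close> they
  detect every coefficient of a combination, and by \<open>expand\<close> they reconstruct every
  kernel vector.\<close>

lemma kernel_dim_eq_card:
  fixes A :: "'a::field mat"
  assumes A: "A \<in> carrier_mat nr nc" and D: "D \<subseteq> {..<nc}"
    and b: "\<And>u. u \<in> D \<Longrightarrow> b u \<in> mat_kernel A"
    and delta: "\<And>u i. u \<in> D \<Longrightarrow> i \<in> D \<Longrightarrow> b u $ i = (if i = u then 1 else 0)"
    and expand: "\<And>v i. v \<in> mat_kernel A \<Longrightarrow> i < nc \<Longrightarrow> v $ i = (\<Sum>u\<in>D. v $ u * b u $ i)"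
  shows "kernel_dim A = card D"
proof -
  interpret kernel nr nc A by unfold_locales (rule A)
  have fin: "finite D" using D finite_subset by blast
  have inj: "inj_on b D"
    using delta by (metis inj_onI zero_neq_one)
  have sub: "b ` D \<subseteq> mat_kernel A" using b by blast
  have lincomb_b: "lincomb a (b ` D) $ i = (\<Sum>u\<in>D. a (b u) * b u $ i)" if "i < nc" for a i
    using lincomb_index[OF that sub] by (simp add: sum.reindex[OF inj])
  have "basis (b ` D)"
    unfolding Ker.basis_def
  proof (intro conjI sub)
    show "\<not> lin_dep (b ` D)"
    proof (rule Ker.finite_lin_indpt2[OF _ sub])
      fix a assume 0: "lincomb a (b ` D) = 0\<^sub>v nc"
      show "\<forall>v\<in>b ` D. a v = 0"
      proof (intro ballI, elim imageE)
        fix v u assume v: "v = b u" and u: "u \<in> D"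
        then have u': "u < nc" using D by auto
        have "0 = (\<Sum>w\<in>D. a (b w) * b w $ u)"
          using lincomb_b[OF u', of a] u' by (simp add: 0)
        also have "\<dots> = (\<Sum>w\<in>D. if w = u then a (b w) else 0)"
          using u by (intro sum.cong) (auto simp: delta)
        also have "\<dots> = a (b u)" using fin u by simp
        finally show "a v = 0" by (simp add: v)
      qed
    qed (use fin in auto)
    show "span (b ` D) = mat_kernel A"
    proof
      show "span (b ` D) \<subseteq> mat_kernel A" using sub by (rule Ker.span_is_subset2)
      show "mat_kernel A \<subseteq> span (b ` D)"
      proof
        fix v assume v: "v \<in> mat_kernel A"
        define a where "a w = v $ inv_into D b w" for w
        have "lincomb a (b ` D) \<in> mat_kernel A" using sub by (rule Ker.lincomb_closed) simp
        then have "lincomb a (b ` D) \<in> carrier_vec nc" "v \<in> carrier_vec nc"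
          using v mat_kernel_carrier[OF A] by auto
        then have "v = lincomb a (b ` D)"
          using v by (intro eq_vecI) (auto simp: lincomb_b expand[of v] a_def inv_into_f_f[OF inj])
        then show "v \<in> span (b ` D)" unfolding Ker.span_def using fin by auto
      qed
    qed
  qed
  then have "dim = card (b ` D)" using fin by (intro Ker.dim_basis) auto
  then show ?thesis by (simp add: card_image[OF inj])
qed

text \<open>The quadratic form of the weighted Laplacian is
  \<open>(1/2) \<Sum>\<^sub>i \<Sum>\<^sub>j c\<^sub>i\<^sub>j |v\<^sub>i - v\<^sub>j|\<^sup>2\<close>; summing the hypothesis over \<open>i\<close> first isolates the sum of \<open>v\<close>.\<close>

lemma weighted_laplacian_plus_ones_kernel:
  fixes c :: "'a \<Rightarrow> 'a \<Rightarrow> real" and v :: "'a \<Rightarrow> complex"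
  assumes fin: "finite I"
    and sym: "\<And>i j. i \<in> I \<Longrightarrow> j \<in> I \<Longrightarrow> c i j = c j i"
    and nonneg: "\<And>i j. i \<in> I \<Longrightarrow> j \<in> I \<Longrightarrow> c i j \<ge> 0"
    and ker: "\<And>i. i \<in> I \<Longrightarrow> (\<Sum>j\<in>I. c i j * (v i - v j)) + (\<Sum>j\<in>I. v j) = 0"
  shows "(\<Sum>j\<in>I. v j) = 0" and "\<And>i j. i \<in> I \<Longrightarrow> j \<in> I \<Longrightarrow> c i j \<noteq> 0 \<Longrightarrow> v i = v j"
proof -
  have "(\<Sum>i\<in>I. \<Sum>j\<in>I. c i j * (v i - v j)) = (\<Sum>i\<in>I. \<Sum>j\<in>I. c j i * (v j - v i))"
    by (rule sum.swap)
  also have "\<dots> = (\<Sum>i\<in>I. \<Sum>j\<in>I. - (c i j * (v i - v j)))"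
    by (rule sum.cong[OF HOL.refl], rule sum.cong[OF HOL.refl], subst sym) (auto simp: algebra_simps)
  also have "\<dots> = - (\<Sum>i\<in>I. \<Sum>j\<in>I. c i j * (v i - v j))"
    by (simp add: sum_negf)
  finally have anti: "(\<Sum>i\<in>I. \<Sum>j\<in>I. c i j * (v i - v j)) = 0"
    by simp
  have "0 = (\<Sum>i\<in>I. (\<Sum>j\<in>I. c i j * (v i - v j)) + (\<Sum>j\<in>I. v j))"
    using ker by simp
  also have "\<dots> = of_nat (card I) * (\<Sum>j\<in>I. v j)"
    by (simp add: sum.distrib anti)
  finally show sum0: "(\<Sum>j\<in>I. v j) = 0"
    using fin by (cases "I = {}") auto
  \<comment> \<open>\<open>X\<close> is the Hermitian form of the weighted Laplacian at
    \<open>v\<close>; \<open>ker\<close> and \<open>sum0\<close> make it vanish.\<close>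
  define X where "X = (\<Sum>i\<in>I. \<Sum>j\<in>I. c i j * (cnj (v i) * (v i - v j)))"
  have "X = (\<Sum>i\<in>I. cnj (v i) * (\<Sum>j\<in>I. c i j * (v i - v j)))"
    unfolding X_def by (simp add: sum_distrib_left mult_ac)
  also have "\<dots> = 0" using ker sum0 by simp
  finally have X0: "X = 0" .
  have "X = (\<Sum>i\<in>I. \<Sum>j\<in>I. c j i * (cnj (v j) * (v j - v i)))"
    unfolding X_def by (rule sum.swap)
  also have "\<dots> = (\<Sum>i\<in>I. \<Sum>j\<in>I. c i j * (cnj (v j) * (v j - v i)))"
    by (intro sum.cong HOL.refl) (simp add: sym)
  \<comment> \<open>Pairing \<open>(i, j)\<close> with \<open>(j, i)\<close> uses
    \<open>cnj x * (x - y) + cnj y * (y - x) = |x - y|^2\<close>. A vanishing sum of nonnegative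
    reals then has only zero terms.\<close>
  finally have "X + X = (\<Sum>i\<in>I. \<Sum>j\<in>I. c i j * (cnj (v i) * (v i - v j)) + c i j * (cnj (v j) * (v j - v i)))"
    by (simp add: X_def sum.distrib)
  also have "\<dots> = (\<Sum>i\<in>I. \<Sum>j\<in>I. complex_of_real (c i j * (cmod (v i - v j))\<^sup>2))"
    by (intro sum.cong HOL.refl) (simp only: of_real_mult complex_norm_square complex_cnj_diff algebra_simps)
  also have "\<dots> = complex_of_real (\<Sum>i\<in>I. \<Sum>j\<in>I. c i j * (cmod (v i - v j))\<^sup>2)"
    by (simp only: of_real_sum)
  finally have "X + X = complex_of_real (\<Sum>i\<in>I. \<Sum>j\<in>I. c i j * (cmod (v i - v j))\<^sup>2)" .
  then have "complex_of_real (\<Sum>i\<in>I. \<Sum>j\<in>I. c i j * (cmod (v i - v j))\<^sup>2) = 0"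
    unfolding X0 by simp
  then have 0: "(\<Sum>i\<in>I. \<Sum>j\<in>I. c i j * (cmod (v i - v j))\<^sup>2) = 0"
    by (rule of_real_eq_0_iff[THEN iffD1])
  fix i j assume ij: "i \<in> I" "j \<in> I" "c i j \<noteq> 0"
  have "(\<Sum>j\<in>I. c i j * (cmod (v i - v j))\<^sup>2) = 0"
    using 0 ij fin nonneg by (subst (asm) sum_nonneg_eq_0_iff) (auto intro!: sum_nonneg)
  then have "c i j * (cmod (v i - v j))\<^sup>2 = 0"
    using ij fin nonneg by (subst (asm) sum_nonneg_eq_0_iff) auto
  then show "v i = v j" using ij by simp
qed

section \<open>The Laplacian eigenvalue equal to the number of vertices\<close>

definition dominating_verts :: "'v pair_pre_digraph \<Rightarrow> 'v set" where
  "dominating_verts \<Gamma> = {u \<in> pverts \<Gamma>. \<forall>w\<in>pverts \<Gamma>. w \<noteq> u \<longrightarrow> (u, w) \<in> parcs \<Gamma>}"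

text \<open>Adjacency in the complement, except that loops are included.\<close>

definition non_adjacent :: "'v pair_pre_digraph \<Rightarrow> 'v rel" where
  "non_adjacent \<Gamma> = (pverts \<Gamma> \<times> pverts \<Gamma>) - parcs \<Gamma>"

lemma laplacian_mat_carrier: "laplacian_mat \<Gamma> vs \<in> carrier_mat (length vs) (length vs)"
  by (simp add: laplacian_mat_def degree_mat_def adjacency_mat_def mat_diag_def minus_carrier_mat)

section \<open>The matrix \<open>L - N I\<close> and its kernel\<close>

context
  fixes \<Gamma> :: "'v pair_pre_digraph" and vs :: "'v list"
  assumes graph: "pair_graph \<Gamma>" and dist: "distinct vs" and set_vs: "set vs = pverts \<Gamma>"
begin

lemma parcs_sym: "(u, w) \<in> parcs \<Gamma> \<longleftrightarrow> (w, u) \<in> parcs \<Gamma>"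
proof -
  interpret pair_graph \<Gamma> by (rule graph)
  show ?thesis using pair_sym_arcs by (auto simp: symmetric_def sym_def)
qed

lemma transpose_laplacian_mat: "transpose_mat (laplacian_mat \<Gamma> vs) = laplacian_mat \<Gamma> vs"
  using parcs_sym
  by (intro eq_matI) (auto simp: laplacian_mat_def degree_mat_def adjacency_mat_def mat_diag_def)

lemma out_degree_eq_sum:
  assumes "i < length vs"
  shows "real (out_degree (with_proj \<Gamma>) (vs ! i))
    = (\<Sum>j<length vs. if (vs ! i, vs ! j) \<in> parcs \<Gamma> then 1 else 0)"
proof -
  have "out_arcs (with_proj \<Gamma>) (vs ! i)
      = (\<lambda>j. (vs ! i, vs ! j)) ` {j \<in> {..<length vs}. (vs ! i, vs ! j) \<in> parcs \<Gamma>}"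
  proof -
    have "w \<in> set vs" if "(u, w) \<in> parcs \<Gamma>" for u w
    proof -
      interpret pair_graph \<Gamma> by (rule graph)
      show ?thesis using that set_vs by (simp add: in_arcsD2)
    qed
    then show ?thesis by (fastforce simp: out_arcs_def in_set_conv_nth)
  qed
  moreover have "inj_on (\<lambda>j. (vs ! i, vs ! j)) {j \<in> {..<length vs}. (vs ! i, vs ! j) \<in> parcs \<Gamma>}"
    using dist by (auto simp: inj_on_def nth_eq_iff_index_eq)
  ultimately show ?thesis
    by (simp add: out_degree_def card_image sum.If_cases Int_def)
qed

text \<open>\<open>char_matrix A e\<close> is \<open>A - e I\<close>, which accounts for the outer
  minus sign. The weight at \<open>j = i\<close> is harmless, as it multiplies
  \<open>v $ i - v $ i\<close>.\<close>

lemma char_matrix_laplacian_mult_vec: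
  fixes v :: "complex vec"
  assumes v: "v \<in> carrier_vec (length vs)" and i: "i < length vs"
  shows "(map_mat complex_of_real (char_matrix (laplacian_mat \<Gamma> vs) (real (length vs))) *\<^sub>v v) $ i
    = - ((\<Sum>j<length vs. complex_of_real (if (vs ! i, vs ! j) \<in> parcs \<Gamma> then 0 else 1) * (v $ i - v $ j))
         + (\<Sum>j<length vs. v $ j))"
proof -
  let ?I = "{..<length vs}"
  let ?a = "\<lambda>j. if (vs ! i, vs ! j) \<in> parcs \<Gamma> then 1 else 0 :: complex"
  let ?d = "real (out_degree (with_proj \<Gamma>) (vs ! i))"
  have "(map_mat complex_of_real (char_matrix (laplacian_mat \<Gamma> vs) (real (length vs))) *\<^sub>v v) $ i
      = (\<Sum>j\<in>?I. ((if j = i then complex_of_real ?d - of_nat (length vs) else 0) - ?a j) * v $ j)"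
    using v i laplacian_mat_carrier[of \<Gamma> vs]
    by (auto simp: scalar_prod_def atLeast0LessThan char_matrix_def laplacian_mat_def
        degree_mat_def adjacency_mat_def mat_diag_def intro!: sum.cong)
  also have "\<dots> = (\<Sum>j\<in>?I. (if j = i then (complex_of_real ?d - of_nat (length vs)) * v $ i else 0) - ?a j * v $ j)"
    by (intro sum.cong) (auto simp: algebra_simps)
  also have "\<dots> = (complex_of_real ?d - of_nat (length vs)) * v $ i - (\<Sum>j\<in>?I. ?a j * v $ j)"
    using i by (simp add: sum_subtractf)
  also have "complex_of_real ?d = (\<Sum>j\<in>?I. ?a j)"
    unfolding out_degree_eq_sum[OF i] by (simp add: if_distrib cong: if_cong)
  \<comment> \<open>The term \<open>N * v $ i\<close> is spread over the \<open>N\<close> summands,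
    so that everything can be compared term by term.\<close>
  also have "((\<Sum>j\<in>?I. ?a j) - of_nat (length vs)) * v $ i - (\<Sum>j\<in>?I. ?a j * v $ j)
      = (\<Sum>j\<in>?I. ?a j * v $ i - v $ i - ?a j * v $ j)"
    by (simp add: sum_subtractf sum_distrib_left algebra_simps)
  also have "\<dots> = (\<Sum>j\<in>?I. - (complex_of_real (if (vs ! i, vs ! j) \<in> parcs \<Gamma> then 0 else 1) * (v $ i - v $ j) + v $ j))"
    by (intro sum.cong) auto
  finally show ?thesis by (simp only: sum_negf sum.distrib)
qed

text \<open>Apply \<open>weighted_laplacian_plus_ones_kernel\<close> with 0/1 weights marking
  non-adjacency; in the other direction every summand vanishes.\<close>

lemma laplacian_mat_kernel_iff:
  fixes v :: "complex vec"
  assumes v: "v \<in> carrier_vec (length vs)"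
  shows "v \<in> mat_kernel (map_mat complex_of_real (char_matrix (laplacian_mat \<Gamma> vs) (real (length vs))))
    \<longleftrightarrow> (\<Sum>j<length vs. v $ j) = 0 \<and>
        (\<forall>i<length vs. \<forall>j<length vs. (vs ! i, vs ! j) \<in> non_adjacent \<Gamma> \<longrightarrow> v $ i = v $ j)"
    (is "_ \<in> mat_kernel ?M \<longleftrightarrow> ?sum \<and> ?const")
proof -
  let ?c = "\<lambda>i j. if (vs ! i, vs ! j) \<in> parcs \<Gamma> then 0 else 1 :: real"
  have M: "?M \<in> carrier_mat (length vs) (length vs)"
    using laplacian_mat_carrier[of \<Gamma> vs] by simp
  have non_adj: "(vs ! i, vs ! j) \<in> non_adjacent \<Gamma> \<longleftrightarrow> ?c i j \<noteq> 0"
    if "i < length vs" "j < length vs" for i j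
    using nth_mem[OF that(1)] nth_mem[OF that(2)] unfolding set_vs non_adjacent_def by simp
  have "v \<in> mat_kernel ?M \<longleftrightarrow> (\<forall>i<length vs. (?M *\<^sub>v v) $ i = 0)"
    using v M by (auto simp: mat_kernel[OF M] vec_eq_iff)
  also have "\<dots> \<longleftrightarrow> (\<forall>i<length vs. (\<Sum>j<length vs. complex_of_real (?c i j) * (v $ i - v $ j))
      + (\<Sum>j<length vs. v $ j) = 0)"
    by (simp only: char_matrix_laplacian_mult_vec[OF v] neg_equal_0_iff_equal cong: conj_cong imp_cong)
  also have "\<dots> \<longleftrightarrow> ?sum \<and> ?const"
  proof (intro iffI)
    assume "?sum \<and> ?const"
    then show "\<forall>i<length vs. (\<Sum>j<length vs. complex_of_real (?c i j) * (v $ i - v $ j))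
      + (\<Sum>j<length vs. v $ j) = 0"
      using non_adj by (auto intro!: sum.neutral)
  next
    assume ker: "\<forall>i<length vs. (\<Sum>j<length vs. complex_of_real (?c i j) * (v $ i - v $ j))
      + (\<Sum>j<length vs. v $ j) = 0"
    have sym: "?c i j = ?c j i" for i j
      using parcs_sym[of "vs ! i" "vs ! j"] by simp
    have ker': "(\<Sum>j<length vs. complex_of_real (?c i j) * (v $ i - v $ j)) + (\<Sum>j<length vs. v $ j) = 0"
      if "i \<in> {..<length vs}" for i
      using ker that by blast
    have ?sum
      by (rule weighted_laplacian_plus_ones_kernel(1)[of "{..<length vs}" ?c, OF _ sym _ ker']) simp_all
    moreover have "v $ i = v $ j" if "i < length vs" "j < length vs" "?c i j \<noteq> 0" for i j
      by (rule weighted_laplacian_plus_ones_kernel(2)[of "{..<length vs}" ?c, OF _ sym _ ker' _ _ that(3)])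
        (simp_all add: that(1,2))
    ultimately show "?sum \<and> ?const" using non_adj by blast
  qed
  finally show ?thesis .
qed

text \<open>A dominating vertex is isolated in the complement, so its coordinate is free; the
  remaining coordinates share one value, fixed by the zero sum. A non-dominating vertex must exist
  to absorb that sum: for a complete graph the multiplicity is one less than the number of
  vertices.\<close>

lemma laplacian_multiplicity_card_verts:
  assumes conn: "\<And>u w. u \<in> pverts \<Gamma> - dominating_verts \<Gamma> \<Longrightarrow> w \<in> pverts \<Gamma> - dominating_verts \<Gamma>
      \<Longrightarrow> (u, w) \<in> (non_adjacent \<Gamma>)\<^sup>*"
    and nonempty: "dominating_verts \<Gamma> \<noteq> pverts \<Gamma>"
  shows "eigenvalue_multiplicity (laplacian_mat \<Gamma> vs) (real (length vs)) = card (dominating_verts \<Gamma>)"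
proof -
  let ?N = "length vs"
  let ?M = "map_mat complex_of_real (char_matrix (laplacian_mat \<Gamma> vs) (real ?N))"
  define D where "D = {i. i < ?N \<and> vs ! i \<in> dominating_verts \<Gamma>}"
  define m where "m = ?N - card D"
  have D: "D \<subseteq> {..<?N}" by (auto simp: D_def)
  then have finD: "finite D" using finite_subset by blast
  have "dominating_verts \<Gamma> \<subset> pverts \<Gamma>" using nonempty by (auto simp: dominating_verts_def)
  then obtain x where "x \<in> set vs" "x \<notin> dominating_verts \<Gamma>"
    unfolding set_vs[symmetric] by blast
  then obtain k where k: "k < ?N" "k \<notin> D"
    by (auto simp: D_def in_set_conv_nth)
  then have "D \<subset> {..<?N}" using D by auto
  then have m: "m > 0" using psubset_card_mono[of "{..<?N}" D] by (simp add: m_def)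
  have card_compl: "card ({..<?N} - D) = m"
    using card_Diff_subset[OF finD D] by (simp add: m_def)
  have M: "?M \<in> carrier_mat ?N ?N"
    using laplacian_mat_carrier[of \<Gamma> vs] by simp
  have non_adj_D: "i = j" if "(vs ! i, vs ! j) \<in> non_adjacent \<Gamma>" "i < ?N" "j < ?N" "i \<in> D \<or> j \<in> D" for i j
    using that parcs_sym[of "vs ! i" "vs ! j"] nth_eq_iff_index_eq[OF dist] set_vs
    by (auto simp: D_def dominating_verts_def non_adjacent_def)
  have const: "v $ i = v $ j" if v: "v \<in> mat_kernel ?M" and i: "i < ?N" "i \<notin> D" and j: "j < ?N" "j \<notin> D"
    for v i j
  proof -
    have "(vs ! i, vs ! j) \<in> (non_adjacent \<Gamma>)\<^sup>*"
    proof (rule conn)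
      show "vs ! i \<in> pverts \<Gamma> - dominating_verts \<Gamma>" "vs ! j \<in> pverts \<Gamma> - dominating_verts \<Gamma>"
        using i j nth_mem[of i vs] nth_mem[of j vs] unfolding set_vs D_def by simp_all
    qed
    \<comment> \<open>The path runs through vertices while \<open>v\<close> is indexed by positions
      in \<open>vs\<close>, so the induction carries a position of the current vertex.\<close>
    then have "\<exists>l<?N. vs ! l = vs ! j \<and> v $ i = v $ l"
    proof (induction rule: rtrancl_induct)
      case (step y z)
      then obtain l where l: "l < ?N" "vs ! l = y" "v $ i = v $ l" by blast
      have "z \<in> set vs" using step.hyps(2) set_vs by (auto simp: non_adjacent_def)
      then obtain l' where l': "l' < ?N" "vs ! l' = z" by (auto simp: in_set_conv_nth)
      have "v $ l = v $ l'"
        using laplacian_mat_kernel_iff[OF mat_kernelD(1)[OF M v]] v l l' step.hyps(2) by blast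
      then show ?case using l l' by auto
    qed (use i in auto)
    then show ?thesis using j nth_eq_iff_index_eq[OF dist] by metis
  qed
  \<comment> \<open>Unit vectors at the dominating positions, corrected by \<open>-1/m\<close> at
    each of the \<open>m\<close> others to make the sum zero.\<close>
  define b where "b u = vec ?N (\<lambda>i. if i \<in> D then if i = u then 1 else 0 else - 1 / of_nat m :: complex)" for u
  have sum_split: "(\<Sum>i<?N. f i) = (\<Sum>i\<in>D. f i) + (\<Sum>i\<in>{..<?N} - D. f i)" for f :: "nat \<Rightarrow> complex"
    using sum.subset_diff[OF D, of f] by (simp add: add.commute)
  have "kernel_dim ?M = card D"
  proof (rule kernel_dim_eq_card[OF M D, of b])
    fix u assume u: "u \<in> D"
    have "(\<Sum>i<?N. b u $ i) = (\<Sum>i\<in>D. if i = u then 1 else 0) + (\<Sum>i\<in>{..<?N} - D. - 1 / of_nat m)"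
      unfolding sum_split using D by (intro arg_cong2[of _ _ _ _ "(+)"] sum.cong) (auto simp: b_def)
    also have "\<dots> = 0" using u finD m by (simp add: card_compl)
    finally have "(\<Sum>i<?N. b u $ i) = 0" .
    moreover have "b u $ i = b u $ j" if "i < ?N" "j < ?N" "(vs ! i, vs ! j) \<in> non_adjacent \<Gamma>" for i j
      using non_adj_D[OF that(3,1,2)] that by (auto simp: b_def)
    ultimately show "b u \<in> mat_kernel ?M"
      by (subst laplacian_mat_kernel_iff) (auto simp: b_def)
  next
    fix u i assume "u \<in> D" "i \<in> D"
    then show "b u $ i = (if i = u then 1 else 0)" using D by (auto simp: b_def)
  next
    fix v i assume v: "v \<in> mat_kernel ?M" and i: "i < ?N"
    show "v $ i = (\<Sum>u\<in>D. v $ u * b u $ i)"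
    proof (cases "i \<in> D")
      case True
      have "(\<Sum>u\<in>D. v $ u * b u $ i) = (\<Sum>u\<in>D. if u = i then v $ u else 0)"
        using True i by (intro sum.cong) (auto simp: b_def)
      then show ?thesis using finD True by simp
    next
      case False
      have "0 = (\<Sum>j<?N. v $ j)"
        using laplacian_mat_kernel_iff[OF mat_kernelD(1)[OF M v]] v by simp
      also have "\<dots> = (\<Sum>j\<in>D. v $ j) + (\<Sum>j\<in>{..<?N} - D. v $ i)"
        unfolding sum_split using const[OF v i False]
        by (intro arg_cong2[of _ _ _ _ "(+)"] sum.cong) auto
      also have "\<dots> = (\<Sum>j\<in>D. v $ j) + of_nat m * v $ i"
        by (simp add: card_compl)
      finally have "v $ i = - (\<Sum>j\<in>D. v $ j) / of_nat m"
        using m by (simp add: field_simps eq_neg_iff_add_eq_0)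
      also have "\<dots> = (\<Sum>u\<in>D. v $ u * b u $ i)"
        using i False by (simp add: b_def sum_divide_distrib sum_negf)
      finally show ?thesis .
    qed
  qed
  moreover have "card D = card (dominating_verts \<Gamma>)"
  proof (rule bij_betw_same_card[of "\<lambda>i. vs ! i"])
    show "bij_betw (\<lambda>i. vs ! i) D (dominating_verts \<Gamma>)"
      unfolding bij_betw_def
    proof
      show "inj_on (\<lambda>i. vs ! i) D" using dist by (auto simp: inj_on_def D_def nth_eq_iff_index_eq)
      have "dominating_verts \<Gamma> \<subseteq> set vs" by (auto simp: set_vs dominating_verts_def)
      then show "(\<lambda>i. vs ! i) ` D = dominating_verts \<Gamma>"
        unfolding D_def by (force simp: in_set_conv_nth)
    qed
  qed
  ultimately show ?thesis
    unfolding eigenvalue_multiplicity_def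
    using order_char_poly_symmetric[OF laplacian_mat_carrier transpose_laplacian_mat] by simp
qed

end

section \<open>The power graph of a dicyclic group\<close>

lemma power_graph_adjacent_iff:
  "(u, w) \<in> parcs (power_graph G) \<longleftrightarrow> u \<in> carrier G \<and> w \<in> carrier G \<and> u \<noteq> w \<and>
     ((\<exists>k::nat. k > 0 \<and> u = w [^]\<^bsub>G\<^esub> k) \<or> (\<exists>k::nat. k > 0 \<and> w = u [^]\<^bsub>G\<^esub> k))"
  by (simp add: power_graph_def)

text \<open>By Lagrange, the group order is a positive exponent that sends every element to
  \<open>\<one>\<close>.\<close>

lemma (in group) one_dominating:
  assumes "finite (carrier G)"
  shows "\<one> \<in> dominating_verts (power_graph G)"
proof -
  have "\<one> = w [^] order G \<and> order G > 0" if "w \<in> carrier G" for w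
    using that assms pow_order_eq_1 order_gt_0_iff_finite by simp
  then show ?thesis
    unfolding dominating_verts_def power_graph_adjacent_iff by (auto simp: power_graph_def)
qed

text \<open>Separates the power-graph argument from words and presentations.
  \<open>a_pow_eq_iff\<close> encodes the exact order of \<open>a\<close>, and
  \<open>a_pow_b_neq\<close> the disjointness of the two cosets of \<open><a>\<close>.\<close>

locale dicyclic = group +
  fixes n :: nat and a b :: 'a
  assumes n: "n \<ge> 2"
    and a_carrier [simp]: "a \<in> carrier G" and b_carrier [simp]: "b \<in> carrier G"
    and a_b: "a \<otimes> b = b \<otimes> inv a"
    and b_b: "b \<otimes> b = a [^] n"
    and a_pow_eq_iff: "a [^] i = a [^] j \<longleftrightarrow> [i = j] (mod 2 * n)"
    and a_pow_b_neq: "a [^] i \<otimes> b \<noteq> a [^] (j::nat)"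
    and carrier_eq: "carrier G = range (\<lambda>i. a [^] (i::nat)) \<union> range (\<lambda>i. a [^] (i::nat) \<otimes> b)"
begin

section \<open>Powers and non-adjacency in the dicyclic group\<close>

lemma finite_carrier: "finite (carrier G)"
proof -
  have "a [^] i \<in> (\<lambda>i. a [^] i) ` {..<2 * n}" for i :: nat
  proof (rule image_eqI)
    show "a [^] i = a [^] (i mod (2 * n))" by (simp add: a_pow_eq_iff)
  qed (use n in simp)
  then have "carrier G \<subseteq> (\<lambda>i. a [^] i) ` {..<2 * n} \<union> (\<lambda>x. x \<otimes> b) ` (\<lambda>i. a [^] i) ` {..<2 * n}"
    unfolding carrier_eq by blast
  then show ?thesis by (rule finite_subset) simp
qed

text \<open>The relation \<open>a b = b a^-1\<close> reads \<open>a b a = b\<close>; the induction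
  cancels one \<open>a\<close> on either side of \<open>b\<close>.\<close>

lemma a_pow_b_a_pow: "a [^] (i::nat) \<otimes> b \<otimes> a [^] i = b"
proof (induction i)
  case (Suc i)
  have "a [^] Suc i \<otimes> b \<otimes> a [^] Suc i = a [^] i \<otimes> (a \<otimes> b) \<otimes> (a \<otimes> a [^] i)"
    unfolding nat_pow_Suc2[OF a_carrier, of i, symmetric] by (simp add: m_assoc)
  also have "\<dots> = a [^] i \<otimes> b \<otimes> ((inv a \<otimes> a) \<otimes> a [^] i)"
    unfolding a_b by (simp only: m_assoc a_carrier b_carrier inv_closed nat_pow_closed m_closed)
  also have "\<dots> = b" using Suc.IH by simp
  finally show ?case .
qed simp

lemma a_pow_b_square: "(a [^] (i::nat) \<otimes> b) \<otimes> (a [^] i \<otimes> b) = a [^] n"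
proof -
  have "(a [^] i \<otimes> b) \<otimes> (a [^] i \<otimes> b) = (a [^] i \<otimes> b \<otimes> a [^] i) \<otimes> b"
    by (simp add: m_assoc)
  then show ?thesis by (simp add: a_pow_b_a_pow b_b)
qed

lemma a_pow_b_pow_even: "(a [^] (i::nat) \<otimes> b) [^] (2 * k :: nat) = a [^] (n * k)"
proof (induction k)
  case (Suc k)
  have "(a [^] i \<otimes> b) [^] (2 * Suc k) = (a [^] i \<otimes> b) [^] (2 * k) \<otimes> ((a [^] i \<otimes> b) \<otimes> (a [^] i \<otimes> b))"
    by (simp add: m_assoc)
  also have "\<dots> = a [^] (n * Suc k)"
    by (simp add: Suc a_pow_b_square nat_pow_mult add.commute)
  finally show ?case .
qed simp

text \<open>Even powers of \<open>a^j b\<close> are powers of \<open>a^n\<close>, odd ones lie in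
  the coset of \<open>b\<close>, and powers of \<open>a^i\<close> never leave
  \<open><a>\<close>.\<close>

lemma a_pow_not_adjacent_a_pow_b:
  assumes "\<not> n dvd i"
  shows "(a [^] i, a [^] (j::nat) \<otimes> b) \<in> non_adjacent (power_graph G)"
proof -
  have "a [^] i \<noteq> (a [^] j \<otimes> b) [^] k" for k :: nat
  proof (cases "even k")
    case True
    then obtain l where "k = 2 * l" by blast
    then have "(a [^] j \<otimes> b) [^] k = a [^] (n * l)" by (simp only: a_pow_b_pow_even)
    \<comment> \<open>Reducing modulo \<open>n\<close>, a divisor of \<open>2 * n\<close>, would
      give \<open>n dvd i\<close>.\<close>
    moreover have "\<not> [i = n * l] (mod 2 * n)"
      using assms cong_dvd_modulus_nat[of i "n * l" "2 * n" n] cong_dvd_iff[of i "n * l" n] by auto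
    ultimately show ?thesis by (simp add: a_pow_eq_iff)
  next
    case False
    then obtain l where "k = Suc (2 * l)" by (metis oddE Suc_eq_plus1)
    then have "(a [^] j \<otimes> b) [^] k = a [^] (n * l) \<otimes> (a [^] j \<otimes> b)"
      by (simp only: nat_pow_Suc a_pow_b_pow_even)
    also have "\<dots> = a [^] (n * l + j) \<otimes> b" by (simp add: m_assoc[symmetric] nat_pow_mult)
    finally show ?thesis using a_pow_b_neq by metis
  qed
  moreover have "a [^] j \<otimes> b \<noteq> (a [^] i) [^] k" for k :: nat
    using a_pow_b_neq by (simp add: nat_pow_pow)
  ultimately show ?thesis
    by (auto simp: non_adjacent_def power_graph_adjacent_iff) (auto simp: power_graph_def)
qed

section \<open>Dominating vertices of the power graph\<close>

lemma non_adjacent_sym: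
  "(u, w) \<in> non_adjacent (power_graph G) \<Longrightarrow> (w, u) \<in> non_adjacent (power_graph G)"
  by (auto simp: non_adjacent_def power_graph_adjacent_iff)

lemma not_dominatingI:
  "(u, w) \<in> non_adjacent (power_graph G) \<Longrightarrow> u \<noteq> w \<Longrightarrow> u \<notin> dominating_verts (power_graph G)"
  by (auto simp: non_adjacent_def dominating_verts_def)

text \<open>For \<open>n \<ge> 2\<close> the generator \<open>a\<close> itself lies outside
  \<open>{\<one>, a^n}\<close>, hence serves as a common non-neighbour of all
  \<open>a^j b\<close>.\<close>

lemma not_n_dvd_1: "\<not> n dvd 1"
  using n by simp

lemma a_pow_b_not_dominating: "a [^] (j::nat) \<otimes> b \<notin> dominating_verts (power_graph G)"
  using not_dominatingI[OF non_adjacent_sym[OF a_pow_not_adjacent_a_pow_b[OF not_n_dvd_1, of j]] a_pow_b_neq] .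

lemma a_pow_not_dominating: "\<not> n dvd i \<Longrightarrow> a [^] i \<notin> dominating_verts (power_graph G)"
  using not_dominatingI[OF a_pow_not_adjacent_a_pow_b[of i 0]] a_pow_b_neq[of 0 i] by simp

lemma a_pow_n_multiple: "n dvd i \<Longrightarrow> a [^] i = \<one> \<or> a [^] i = a [^] n"
proof -
  assume "n dvd i"
  then obtain k where i: "i = n * k" by blast
  have "[i = 0] (mod 2 * n)" if "even k" using that i by (auto simp: cong_0_iff)
  moreover have "[i = n] (mod 2 * n)" if "odd k"
  proof -
    from that obtain l where "k = 2 * l + 1" by (rule oddE)
    then have "i = n + l * (2 * n)" by (simp add: i algebra_simps)
    then show ?thesis by (simp add: cong_def)
  qed
  ultimately show ?thesis using a_pow_eq_iff by (metis nat_pow_0)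
qed

lemma a_pow_n_neq_one: "a [^] n \<noteq> \<one>"
proof -
  have "\<not> [n = 0] (mod 2 * n)" using n by (auto simp: cong_0_iff dest: dvd_imp_le)
  then show ?thesis using a_pow_eq_iff[of n 0] by simp
qed

text \<open>Here \<open><a>\<close> is a cyclic 2-group, so its unique involution \<open>a^n\<close>
  is a power of each of its nontrivial elements; outside \<open><a>\<close> every element squares to
  \<open>a^n\<close>.\<close>

lemma a_pow_n_dominating:
  assumes "n = 2 ^ k"
  shows "a [^] n \<in> dominating_verts (power_graph G)"
proof -
  have a_pow: "\<exists>m::nat. m > 0 \<and> a [^] n = (a [^] i) [^] m" if "a [^] i \<noteq> \<one>" for i :: nat
  proof -
    \<comment> \<open>Reduction modulo \<open>2 * n = 2 ^ Suc k\<close> bounds the 2-adic valuation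
      \<open>t\<close> of the exponent by \<open>k\<close>, so that \<open>k - t\<close> doublings
      lead to \<open>n * l\<close>.\<close>
    define i' where "i' = i mod (2 * n)"
    have "\<not> [i = 0] (mod 2 * n)" using that a_pow_eq_iff[of i 0] by simp
    then have i': "0 < i'" "i' < 2 * n"
      using n by (auto simp: i'_def cong_def)
    define t where "t = multiplicity 2 i'"
    obtain l where l: "i' = 2 ^ t * l" "odd l"
      unfolding t_def using multiplicity_decompose'[of i' 2] i' by auto
    have "2 ^ t \<le> i'" using l(1) i'(1) by simp
    then have "2 ^ t < (2::nat) ^ Suc k" using i'(2) assms by simp
    then have "t \<le> k" using power_less_imp_less_exp[of "2::nat" t "Suc k"] by simp
    then have "i' * 2 ^ (k - t) = n * l"
      by (simp add: l(1) assms power_add[symmetric] mult_ac)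
    moreover obtain q where "l = 2 * q + 1" using l(2) by (rule oddE)
    \<comment> \<open>As \<open>l\<close> is odd, \<open>n * l\<close> is congruent to
      \<open>n\<close> modulo \<open>2 * n\<close>.\<close>
    ultimately have "i' * 2 ^ (k - t) = n + q * (2 * n)" by (simp add: algebra_simps)
    then have "[n = i' * 2 ^ (k - t)] (mod 2 * n)" by (simp add: cong_def)
    also have "[i' * 2 ^ (k - t) = i * 2 ^ (k - t)] (mod 2 * n)"
      unfolding i'_def by (intro cong_mult) (auto simp: cong_def)
    finally have "a [^] n = (a [^] i) [^] ((2::nat) ^ (k - t))"
      by (simp add: a_pow_eq_iff nat_pow_pow)
    moreover have "(2::nat) ^ (k - t) > 0" by simp
    ultimately show ?thesis by blast
  qed
  have "(a [^] n, w) \<in> parcs (power_graph G)" if "w \<in> carrier G" "w \<noteq> a [^] n" for w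
  proof (cases "w = \<one>")
    case True
    have "(\<one>, a [^] n) \<in> parcs (power_graph G)"
      using one_dominating[OF finite_carrier] that True
      by (simp add: dominating_verts_def power_graph_def)
    then show ?thesis
      unfolding True by (simp only: power_graph_adjacent_iff) metis
  next
    case False
    have "\<exists>m::nat. m > 0 \<and> a [^] n = w [^] m"
      using that(1) unfolding carrier_eq
    proof (elim UnE imageE)
      fix i assume "w = a [^] (i::nat)"
      then show ?thesis using a_pow False by blast
    next
      fix i assume "w = a [^] (i::nat) \<otimes> b"
      then show ?thesis using a_pow_b_pow_even[of i 1] by (intro exI[of _ 2]) simp
    qed
    then show ?thesis using that by (auto simp: power_graph_adjacent_iff)
  qed
  then show ?thesis by (auto simp: dominating_verts_def power_graph_def)
qed

text \<open>Used twice: it stops \<open>a^n\<close> from dominating, and it links \<open>a^n\<close>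
  to the rest of the complement, where \<open>\<not> n dvd i\<close> guarantees an onward step to
  \<open>b\<close>.\<close>

lemma a_pow_n_non_adjacent:
  assumes "\<nexists>k. n = 2 ^ k"
  obtains i where "\<not> n dvd i" "(a [^] n, a [^] i) \<in> non_adjacent (power_graph G)"
proof -
  \<comment> \<open>The odd part \<open>p\<close> of \<open>n\<close> exceeds 1 because
    \<open>n\<close> is no power of two.\<close>
  obtain p where n_eq: "n = 2 ^ multiplicity 2 n * p" and "odd p"
    using multiplicity_decompose'[of n 2] n by auto
  define m where "m = (2::nat) ^ multiplicity 2 n"
  have nmp: "n = m * p" and m: "m > 0" using n_eq by (auto simp: m_def)
  have "p \<noteq> 1" using n_eq assms by force
  then have p: "\<not> p dvd 2" using \<open>odd p\<close> dvd_imp_le[of p 2]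
    by (cases "p = 2") (auto simp: le_Suc_eq numeral_2_eq_2)
  show thesis
  proof
    \<comment> \<open>\<open>a\<^sup>2\<^sup>m\<close> has odd order \<open>p > 1\<close>, so neither it nor the involution \<open>a\<^sup>n\<close> generates the other.\<close>
    show "\<not> n dvd 2 * m" using p m by (simp add: nmp mult.commute[of m])
    \<comment> \<open>After division by \<open>m\<close>, such a congruence would make
      \<open>p\<close> even.\<close>
    have "\<not> [n = 2 * m * k] (mod 2 * n)" for k
    proof
      assume "[n = 2 * m * k] (mod 2 * n)"
      then have "[m * p = m * (2 * k)] (mod m * (2 * p))" by (simp add: nmp mult_ac)
      then have "[p = 2 * k] (mod 2 * p)" using m by (simp add: cong_mult_lcancel_nat cong_def mult_mod_right[symmetric])
      then have "[p = 2 * k] (mod 2)" by (rule cong_dvd_modulus_nat) simp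
      then show False using \<open>odd p\<close> by (simp add: cong_def odd_iff_mod_2_eq_one)
    qed
    \<comment> \<open>After division by \<open>m\<close>, such a congruence would make
      \<open>p\<close> a divisor of 2.\<close>
    moreover have "\<not> [2 * m = n * k] (mod 2 * n)" for k
    proof
      assume "[2 * m = n * k] (mod 2 * n)"
      then have "[m * 2 = m * (p * k)] (mod m * (2 * p))" by (simp add: nmp mult_ac)
      then have "[2 = p * k] (mod 2 * p)" using m by (simp add: cong_def mult_mod_right[symmetric])
      then have "[2 = p * k] (mod p)" by (rule cong_dvd_modulus_nat) simp
      then show False using p by (simp add: cong_dvd_iff)
    qed
    ultimately show "(a [^] n, a [^] (2 * m)) \<in> non_adjacent (power_graph G)"
      by (auto simp: non_adjacent_def power_graph_adjacent_iff nat_pow_pow a_pow_eq_iff)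
         (auto simp: power_graph_def)
  qed
qed

lemma dominating_verts_power_graph:
  "dominating_verts (power_graph G) = (if \<exists>k. n = 2 ^ k then {\<one>, a [^] n} else {\<one>})"
proof -
  have "dominating_verts (power_graph G) \<subseteq> {\<one>, a [^] n}"
  proof
    fix w assume w: "w \<in> dominating_verts (power_graph G)"
    then have "w \<in> carrier G" by (simp add: dominating_verts_def power_graph_def)
    then show "w \<in> {\<one>, a [^] n}"
      unfolding carrier_eq using w a_pow_b_not_dominating a_pow_not_dominating a_pow_n_multiple
      by blast
  qed
  moreover have "a [^] n \<notin> dominating_verts (power_graph G)" if "\<nexists>k. n = 2 ^ k"
  proof -
    obtain i where i: "\<not> n dvd i" "(a [^] n, a [^] i) \<in> non_adjacent (power_graph G)"
      using a_pow_n_non_adjacent[OF \<open>\<nexists>k. n = 2 ^ k\<close>] .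
    \<comment> \<open>Distinctness has to be shown because \<open>non_adjacent\<close> contains
      loops.\<close>
    have "a [^] n \<noteq> a [^] i"
      using i(1) cong_dvd_modulus_nat[of n i "2 * n" n] cong_dvd_iff[of n i n]
      by (auto simp: a_pow_eq_iff)
    then show ?thesis using i(2) not_dominatingI by blast
  qed
  ultimately show ?thesis
    using one_dominating[OF finite_carrier] a_pow_n_dominating by auto
qed

lemma card_dominating_verts_power_graph:
  "card (dominating_verts (power_graph G)) = (if \<exists>k. n = 2 ^ k then 2 else 1)"
  using a_pow_n_neq_one by (simp add: dominating_verts_power_graph)

text \<open>\<open>b\<close> is a hub: \<open>a^i\<close> with \<open>\<not> n dvd i\<close> is
  linked to it directly, every \<open>a^j b\<close> through \<open>a\<close>, and a non-dominating
  \<open>a^n\<close> through the witness of \<open>a_pow_n_non_adjacent\<close>.\<close>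

lemma power_graph_complement_connected:
  assumes "u \<in> pverts (power_graph G) - dominating_verts (power_graph G)"
    and "w \<in> pverts (power_graph G) - dominating_verts (power_graph G)"
  shows "(u, w) \<in> (non_adjacent (power_graph G))\<^sup>*"
proof -
  let ?R = "non_adjacent (power_graph G)"
  have b_a: "(a [^] i, b) \<in> ?R" if "\<not> n dvd i" for i
    using a_pow_not_adjacent_a_pow_b[OF that, of 0] by simp
  have to_b: "(x, b) \<in> ?R\<^sup>*" if x: "x \<in> pverts (power_graph G) - dominating_verts (power_graph G)" for x
  proof -
    have "x \<in> carrier G" using x by (simp add: power_graph_def)
    then show ?thesis
      unfolding carrier_eq
    proof (elim UnE imageE)
      fix j assume "x = a [^] (j::nat) \<otimes> b"
      then show ?thesis
        using non_adjacent_sym[OF a_pow_not_adjacent_a_pow_b[OF not_n_dvd_1, of j]] b_a[OF not_n_dvd_1]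
        by (blast intro: converse_rtrancl_into_rtrancl)
    next
      fix i assume xi: "x = a [^] (i::nat)"
      show ?thesis
      proof (cases "n dvd i")
        case False
        then show ?thesis using b_a xi by blast
      next
        case True
        \<comment> \<open>\<open>x\<close> is \<open>\<one>\<close> or \<open>a^n\<close>; not being
          dominating leaves only \<open>a^n\<close>, and only when \<open>n\<close> is no power of
          two.\<close>
        have "\<nexists>k. n = 2 ^ k" "x = a [^] n"
          using a_pow_n_multiple[OF True] x xi dominating_verts_power_graph by (auto split: if_splits)
        then obtain l where "\<not> n dvd l" "(x, a [^] l) \<in> ?R"
          using a_pow_n_non_adjacent by metis
        then show ?thesis using b_a by (blast intro: converse_rtrancl_into_rtrancl)
      qed
    qed
  qed
  have "sym (?R\<^sup>*)" using non_adjacent_sym by (intro sym_rtrancl) (auto simp: sym_def)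
  then have "(b, w) \<in> ?R\<^sup>*" using to_b[OF assms(2)] by (rule symD)
  with to_b[OF assms(1)] show ?thesis by (rule rtrancl_trans)
qed

end

section \<open>The presented dicyclic group\<close>

text \<open>The action on \<open>(0, False)\<close> recovers the exponents of a normal form, that of
  \<open>a\<close> modulo \<open>2 * n\<close>, and so separates group elements.\<close>

lemma foldr_dic_step_a_pow_b:
  assumes "n > 0"
  shows "foldr (dic_step n) (dic_nf i (of_bool s)) (0, False) = (int i mod (2 * int n), s)"
  using foldr_dic_step_a[of 0 n i s] assms by (cases s) auto

lemma presented_group_pow:
  "pres_class R u [^]\<^bsub>presented_group R\<^esub> (k::nat) = pres_class R (concat (replicate k u))"
proof (induction k)
  case (Suc k)
  \<comment> \<open>Group powers append a factor on the right, \<open>replicate\<close> adds one on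
    the left.\<close>
  have "concat (replicate k u) @ u = u @ concat (replicate k u)" by (induction k) auto
  with Suc show ?case by (simp add: presented_group_mult)
qed (simp add: presented_group_one)

text \<open>The equations follow from the relations, the inequalities from the invariant action
  \<open>dic_step\<close>, and the description of the carrier from the existence of normal
  forms.\<close>

lemma dicyclic_dicyclic_group:
  assumes n: "n \<ge> 2"
  defines "a \<equiv> pres_class (dicyclic_relations n) [wa]"
    and "b \<equiv> pres_class (dicyclic_relations n) [wb]"
  shows "dicyclic (dicyclic_group n) n a b"
proof -
  let ?R = "dicyclic_relations n" and ?G = "dicyclic_group n"
  interpret group ?G by (rule group_dicyclic_group)
  have rel: "pres_class ?R l = pres_class ?R r" if "(l, r) \<in> ?R" for l r
    using pres_eq.rel[OF that] by (simp add: pres_class_eq_iff)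
  have a_2n_word: "pres_class ?R (replicate (2 * n) wa) = pres_class ?R []"
    and a_n_word: "pres_class ?R (replicate n wa) = pres_class ?R [wb, wb]"
    and ab_word: "pres_class ?R [wa, wb] = pres_class ?R [wb, wa_inv]"
    by (rule rel, simp add: dicyclic_relations_def)+
  have in_carrier: "pres_class ?R u \<in> carrier ?G" for u
    by (simp add: dicyclic_group_def presented_group_carrier)
  have mult: "pres_class ?R u \<otimes>\<^bsub>?G\<^esub> pres_class ?R v = pres_class ?R (u @ v)" for u v
    by (simp add: dicyclic_group_def presented_group_mult)
  have one: "\<one>\<^bsub>?G\<^esub> = pres_class ?R []"
    by (simp add: dicyclic_group_def presented_group_one)
  have a_pow: "a [^]\<^bsub>?G\<^esub> i = pres_class ?R (dic_nf i (of_bool False))" for i :: nat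
    by (simp add: a_def dicyclic_group_def presented_group_pow concat_replicate_single)
  have a_pow_b: "a [^]\<^bsub>?G\<^esub> i \<otimes>\<^bsub>?G\<^esub> b = pres_class ?R (dic_nf i (of_bool True))" for i :: nat
    by (simp add: a_pow b_def mult)
  have nf_eq: "[i = i'] (mod 2 * n) \<and> s = s'"
    if "pres_class ?R (dic_nf i (of_bool s)) = pres_class ?R (dic_nf i' (of_bool s'))" for i i' s s'
  proof -
    have "foldr (dic_step n) (dic_nf i (of_bool s)) (0, False) = foldr (dic_step n) (dic_nf i' (of_bool s')) (0, False)"
      using that n by (intro pres_eq_imp_foldr_dic_step_eq) (auto simp: pres_class_eq_iff)
    then have "int i mod int (2 * n) = int i' mod int (2 * n)" "s = s'"
      using n by (auto simp: foldr_dic_step_a_pow_b simp del: foldr_append)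
    then show ?thesis by (simp only: cong_int_iff[symmetric] cong_def)
  qed
  have a_2n: "a [^]\<^bsub>?G\<^esub> (2 * n) = \<one>\<^bsub>?G\<^esub>"
    by (simp add: a_pow one a_2n_word)
  \<comment> \<open>Supplies the direction of \<open>a_pow_eq_iff\<close> from congruence to
    equality.\<close>
  have a_mod: "a [^]\<^bsub>?G\<^esub> i = a [^]\<^bsub>?G\<^esub> (i mod (2 * n))" for i
  proof -
    have "a [^]\<^bsub>?G\<^esub> i = a [^]\<^bsub>?G\<^esub> (2 * n * (i div (2 * n)) + i mod (2 * n))" by simp
    also have "\<dots> = (a [^]\<^bsub>?G\<^esub> (2 * n)) [^]\<^bsub>?G\<^esub> (i div (2 * n)) \<otimes>\<^bsub>?G\<^esub> a [^]\<^bsub>?G\<^esub> (i mod (2 * n))"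
      by (simp only: nat_pow_mult nat_pow_pow in_carrier a_def)
    also have "\<dots> = a [^]\<^bsub>?G\<^esub> (i mod (2 * n))" unfolding a_2n by (simp add: in_carrier a_def)
    finally show ?thesis .
  qed
  have inv_a: "inv\<^bsub>?G\<^esub> a = pres_class ?R [wa_inv]"
  proof (rule inv_equality)
    show "pres_class ?R [wa_inv] \<otimes>\<^bsub>?G\<^esub> a = \<one>\<^bsub>?G\<^esub>"
      using pres_eq.cancel[of ?R Gen_a False] by (simp add: a_def mult one pres_class_eq_iff)
  qed (simp_all add: a_def in_carrier)
  show ?thesis
  proof
    show "2 \<le> n" by (rule n)
    show "a \<in> carrier ?G" "b \<in> carrier ?G" by (simp_all add: a_def b_def in_carrier)
    show "a \<otimes>\<^bsub>?G\<^esub> b = b \<otimes>\<^bsub>?G\<^esub> inv\<^bsub>?G\<^esub> a"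
      unfolding inv_a by (simp add: a_def b_def mult ab_word)
    show "b \<otimes>\<^bsub>?G\<^esub> b = a [^]\<^bsub>?G\<^esub> n"
      by (simp add: a_pow b_def mult a_n_word)
    show "a [^]\<^bsub>?G\<^esub> i = a [^]\<^bsub>?G\<^esub> j \<longleftrightarrow> [i = j] (mod 2 * n)" for i j
    proof
      assume "a [^]\<^bsub>?G\<^esub> i = a [^]\<^bsub>?G\<^esub> j"
      then show "[i = j] (mod 2 * n)" using nf_eq[of i False j False] unfolding a_pow by blast
    next
      assume "[i = j] (mod 2 * n)"
      then show "a [^]\<^bsub>?G\<^esub> i = a [^]\<^bsub>?G\<^esub> j"
        unfolding cong_def by (subst (1 2) a_mod) (rule arg_cong)
    qed
    show "a [^]\<^bsub>?G\<^esub> i \<otimes>\<^bsub>?G\<^esub> b \<noteq> a [^]\<^bsub>?G\<^esub> j" for i j :: nat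
      using nf_eq[of i True j False] unfolding a_pow_b unfolding a_pow by blast
    have "X \<in> range (\<lambda>i. a [^]\<^bsub>?G\<^esub> (i::nat)) \<union> range (\<lambda>i. a [^]\<^bsub>?G\<^esub> (i::nat) \<otimes>\<^bsub>?G\<^esub> b)"
      if X: "X \<in> carrier ?G" for X
    proof -
      obtain w where "X = pres_class ?R w"
        using X by (auto simp: dicyclic_group_def presented_group_carrier)
      moreover obtain i j where "j < 2" "pres_eq ?R w (dic_nf i j)"
        using dic_normal_form_exists[of n w] n by auto
      ultimately have "X = pres_class ?R (dic_nf i (of_bool (j = 1)))"
        by (auto simp: pres_class_eq_iff less_2_cases_iff)
      then have "X = a [^]\<^bsub>?G\<^esub> i \<or> X = a [^]\<^bsub>?G\<^esub> i \<otimes>\<^bsub>?G\<^esub> b"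
        unfolding a_pow_b unfolding a_pow by (cases "j = 1") simp_all
      then show ?thesis by blast
    qed
    moreover have "a [^]\<^bsub>?G\<^esub> i \<in> carrier ?G" "a [^]\<^bsub>?G\<^esub> i \<otimes>\<^bsub>?G\<^esub> b \<in> carrier ?G" for i :: nat
      by (simp_all add: a_def b_def in_carrier)
    ultimately show "carrier ?G = range (\<lambda>i. a [^]\<^bsub>?G\<^esub> (i::nat)) \<union> range (\<lambda>i. a [^]\<^bsub>?G\<^esub> (i::nat) \<otimes>\<^bsub>?G\<^esub> b)"
      by blast
  qed
qed

theorem theorem3p9:
  fixes n :: nat and vs :: "dic_gen word set list"
  assumes "n \<ge> 2"
    and "distinct vs" and "set vs = pverts (power_graph (dicyclic_group n))"
  shows "eigenvalue_multiplicity (laplacian_mat (power_graph (dicyclic_group n)) vs) (4 * real n)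
           = (if \<exists>k::nat. n = 2 ^ k then 2 else 1)"
proof -
  let ?\<Gamma> = "power_graph (dicyclic_group n)"
  interpret dicyclic "dicyclic_group n" n "pres_class (dicyclic_relations n) [wa]"
      "pres_class (dicyclic_relations n) [wb]"
    using assms(1) by (rule dicyclic_dicyclic_group)
  have "set vs = carrier (dicyclic_group n)"
    using assms(3) by (simp add: power_graph_def)
  then have len: "length vs = 4 * n"
    using distinct_card[OF assms(2)] card_dicyclic_group[of n] assms(1) by simp
  have "dominating_verts ?\<Gamma> \<noteq> pverts ?\<Gamma>"
    using a_pow_b_not_dominating[of 0] by (auto simp: power_graph_def)
  then have "eigenvalue_multiplicity (laplacian_mat ?\<Gamma> vs) (real (length vs)) = card (dominating_verts ?\<Gamma>)"
    using power_graph_complement_connected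
    by (intro laplacian_multiplicity_card_verts pair_graph_power_graph finite_carrier assms(2,3))
  then show ?thesis
    by (simp add: len card_dominating_verts_power_graph)
qed

end
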